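(* For any $k\ge2$ and $0\le a\le k-1$, the lower-triangular array $D^{k,a}$ whose $(n,m)$-entry is $D^{k,a}_{n,m}$ ($0\le m\le n$) is a proper Riordan array with $A$-sequence and $Z$-sequence $$A(t)=(1+t)^k,\qquad Z(t)=\frac{(1+t)^k-(1+t)^{k-a-1}}{t}.$$
   Context: For $k\ge2$ and $a\ge0$, a generalized $k$-Dyck path of depth $a$, semilength $n$ and semiheight $m$ is an integer lattice path from $(0,0)$ to $(kn,km)$ using steps $U=(1,1)$ and $D_{k-1}=(1,1-k)$ that stays weakly above the line $y=-a$; $D^{k,a}_{n,m}$ is the number of such paths. A proper Riordan array $\mathcal R(d(t),h(t))$, for formal power series with $d(0)\ne0$, $h(0)=0$, $h'(0)\neq 0$, is the lower-triangular array with $(i,j)$-entry $d_{i,j}=[t^i]\,d(t)h(t)^j$. Power series $A(t)=\sum a_rt^r$ and $Z(t)=\sum z_rt^r$ are its $A$-sequence and $Z$-sequence if for all $i\ge1$: $d_{i,j}=\sum_{r\ge0}a_r d_{i-1,j-1+r}$ for $j\ge1$ and $d_{i,0}=\sum_{r\ge0} z_r d_{i-1,r}$. *)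

theory Defs
  imports "HOL-Computational_Algebra.Formal_Power_Series" "HOL-Library.Product_Plus"
begin

(* A path starting at the origin is the list of its steps (added componentwise), so the
   points it visits are the partial sums.  Between two consecutive lattice points the path
   is a straight segment, so it suffices to bound the height at those points. *)
definition gen_dyck_paths :: "nat \<Rightarrow> nat \<Rightarrow> nat \<Rightarrow> nat \<Rightarrow> (int \<times> int) list set" where
  "gen_dyck_paths k a n m =
     {p. set p \<subseteq> {(1, 1), (1, 1 - int k)} \<and>
         sum_list p = (int (k * n), int (k * m)) \<and>
         (\<forall>i\<le>length p. - int a \<le> snd (sum_list (take i p)))}"

definition gen_dyck_number :: "nat \<Rightarrow> nat \<Rightarrow> nat \<Rightarrow> nat \<Rightarrow> nat" where
  "gen_dyck_number k a n m = card (gen_dyck_paths k a n m)"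

definition gen_dyck_array :: "nat \<Rightarrow> nat \<Rightarrow> nat \<Rightarrow> nat \<Rightarrow> 'a::field_char_0" where
  "gen_dyck_array k a n m = (if m \<le> n then of_nat (gen_dyck_number k a n m) else 0)"

definition riordan_array :: "'a::field_char_0 fps \<Rightarrow> 'a fps \<Rightarrow> nat \<Rightarrow> nat \<Rightarrow> 'a" where
  "riordan_array d h i j = fps_nth (d * h ^ j) i"

(* h'(0) is the coefficient of t in h. *)
definition proper_riordan_array :: "(nat \<Rightarrow> nat \<Rightarrow> 'a::field_char_0) \<Rightarrow> bool" where
  "proper_riordan_array M \<longleftrightarrow>
     (\<exists>d h. fps_nth d 0 \<noteq> 0 \<and> fps_nth h 0 = 0 \<and> fps_nth h 1 \<noteq> 0 \<and> M = riordan_array d h)"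

(* Both notions are meant for lower-triangular arrays M.  The sums over all r \<ge> 0 are then
   finite: the terms with r > i below contain an entry M i (j + r), respectively M i r,
   above the diagonal.  Row and column indices are shifted by one to avoid subtraction. *)
definition is_A_sequence :: "(nat \<Rightarrow> nat \<Rightarrow> 'a::field_char_0) \<Rightarrow> 'a fps \<Rightarrow> bool" where
  "is_A_sequence M A \<longleftrightarrow>
     (\<forall>i j. M (Suc i) (Suc j) = (\<Sum>r\<le>i. fps_nth A r * M i (j + r)))"

definition is_Z_sequence :: "(nat \<Rightarrow> nat \<Rightarrow> 'a::field_char_0) \<Rightarrow> 'a fps \<Rightarrow> bool" where
  "is_Z_sequence M Z \<longleftrightarrow>
     (\<forall>i. M (Suc i) 0 = (\<Sum>r\<le>i. fps_nth Z r * M i r))"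

end

theory Submission imports Defs begin

text \<open>
  Reading a path backwards from its end point, a block of \<open>k\<close> consecutive steps can only violate
  the lower bound if the end point has height below \<open>k\<close>. A path ending at height \<open>km\<close> with
  \<open>m \<ge> 1\<close> may thus have an arbitrary last block, with \<open>s\<close> down steps in \<open>k choose s\<close> ways, which
  gives \<open>A\<close>. A path ending at height \<open>0\<close> must not have \<open>a + 1\<close> trailing up steps, which excludes
  \<open>(k - a - 1) choose s\<close> of these blocks and gives \<open>Z\<close>. Conversely, a lower-triangular array with
  an \<open>A\<close>- and a \<open>Z\<close>-sequence is the Riordan array of \<open>h = t A(h)\<close> and
  \<open>d = d\<^sub>0 / (1 - t Z(h))\<close>.
\<close>

section \<open>Riordan arrays from their A- and Z-sequences\<close>

text \<open>Turns the right-hand side of an \<open>A\<close>- or \<open>Z\<close>-recurrence into a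
  single coefficient. The sum may stop at \<open>i\<close> because \<open>h ^ r\<close> has no terms
  below degree \<open>r\<close>.\<close>

lemma fps_nth_mult_compose:
  fixes A F h :: "'a::idom fps"
  assumes "fps_nth h 0 = 0"
  shows "fps_nth (F * (A oo h)) i = (\<Sum>r\<le>i. fps_nth A r * fps_nth (F * h ^ r) i)"
proof -
  have trunc: "fps_nth (A oo h) u = (\<Sum>r\<le>i. fps_nth A r * fps_nth (h ^ r) u)" if "u \<le> i" for u
    unfolding fps_compose_nth atLeast0AtMost
    using that startsby_zero_power_prefix[OF assms]
    by (intro sum.mono_neutral_left) auto
  have "fps_nth (F * (A oo h)) i
      = (\<Sum>u\<le>i. fps_nth F u * (\<Sum>r\<le>i. fps_nth A r * fps_nth (h ^ r) (i - u)))"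
    by (simp add: fps_mult_nth atLeast0AtMost trunc)
  also have "\<dots> = (\<Sum>r\<le>i. \<Sum>u\<le>i. fps_nth F u * (fps_nth A r * fps_nth (h ^ r) (i - u)))"
    unfolding sum_distrib_left by (rule sum.swap)
  also have "\<dots> = (\<Sum>r\<le>i. fps_nth A r * fps_nth (F * h ^ r) i)"
    by (simp add: fps_mult_nth atLeast0AtMost sum_distrib_left mult.left_commute)
  finally show ?thesis .
qed

text \<open>The compositional inverse of g = t / A(t) serves as \<open>h\<close>: the equation g(h)
  = t says that h = t A(h).\<close>

lemma fps_fixed_point_exists:
  fixes A :: "'a::field fps"
  assumes "fps_nth A 0 \<noteq> 0"
  obtains h where "fps_nth h 0 = 0" "fps_nth h 1 = fps_nth A 0" "h = fps_X * (A oo h)"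
proof -
  define g where "g = fps_X * inverse A"
  define h where "h = fps_inv g"
  have h0: "fps_nth h 0 = 0"
    by (simp add: h_def fps_inv_def)
  have "g oo h = fps_X"
    unfolding h_def by (rule fps_inv_right) (use assms in \<open>auto simp: g_def\<close>)
  then have "h * inverse (A oo h) = fps_X"
    using assms h0
    by (simp add: g_def fps_compose_mult_distrib fps_inverse_compose)
  then have "fps_X * (A oo h) = h * (inverse (A oo h) * (A oo h))"
    by (simp add: mult.assoc)
  also have "\<dots> = h"
    using assms by (simp add: inverse_mult_eq_1)
  finally have h: "h = fps_X * (A oo h)" ..
  have "fps_nth h 1 = fps_nth (fps_X * (A oo h)) 1"
    by (rule arg_cong[OF h])
  then have "fps_nth h 1 = fps_nth A 0"
    by simp
  with h0 h show ?thesis by (intro that)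
qed

text \<open>Row 0 and the two recurrences determine every later row, so induction on the row index
  identifies \<open>M\<close> with a Riordan array obeying the same recurrences.\<close>

lemma proper_riordan_arrayI:
  fixes M :: "nat \<Rightarrow> nat \<Rightarrow> 'a::field_char_0"
  assumes triangular: "\<And>j. M 0 (Suc j) = 0" and M00: "M 0 0 \<noteq> 0"
    and A: "is_A_sequence M A" and A0: "fps_nth A 0 \<noteq> 0" and Z: "is_Z_sequence M Z"
  shows "proper_riordan_array M"
proof -
  obtain h where h: "fps_nth h 0 = 0" "fps_nth h 1 = fps_nth A 0" "h = fps_X * (A oo h)"
    using fps_fixed_point_exists[OF A0] .
  define e where "e = 1 - fps_X * (Z oo h)"
  define d where "d = fps_const (M 0 0) * inverse e"
  have e0: "fps_nth e 0 = 1"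
    by (simp add: e_def)
  \<comment> \<open>Clearing the denominator gives d = d_0 + t d Z(h), whose coefficient of t^(i+1)
    is the \<open>Z\<close>-recurrence.\<close>
  have "d * e = fps_const (M 0 0) * (inverse e * e)"
    by (simp add: d_def mult.assoc)
  also have "\<dots> = fps_const (M 0 0)"
    using e0 by (simp add: inverse_mult_eq_1)
  finally have d: "d = fps_const (M 0 0) + fps_X * (d * (Z oo h))"
    by (simp add: e_def algebra_simps)
  have d0: "fps_nth d 0 = M 0 0"
    by (simp add: d_def e0)
  have "M i j = riordan_array d h i j" for i j
  proof (induction i arbitrary: j)
    case 0
    show ?case
      by (cases j) (simp_all add: riordan_array_def triangular d0 h(1))
  next
    case (Suc i)
    show ?case
    proof (cases j)
      case 0
      have "fps_nth d (Suc i) = fps_nth (fps_const (M 0 0) + fps_X * (d * (Z oo h))) (Suc i)"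
        by (rule arg_cong[OF d])
      also have "\<dots> = (\<Sum>r\<le>i. fps_nth Z r * fps_nth (d * h ^ r) i)"
        using fps_nth_mult_compose[OF h(1), of d Z i] by simp
      finally show ?thesis
        using Z 0 Suc.IH by (simp add: is_Z_sequence_def riordan_array_def)
    next
      case (Suc j')
      \<comment> \<open>One factor \<open>h\<close> is traded for t A(h): the t leads to the
        previous row, and A(h) spreads over the columns from \<open>j'\<close> on.\<close>
      have "d * h ^ j = (d * h ^ j') * h"
        by (simp add: Suc mult_ac)
      also have "\<dots> = (d * h ^ j') * (fps_X * (A oo h))"
        by (rule arg_cong[OF h(3)])
      also have "\<dots> = fps_X * ((d * h ^ j') * (A oo h))"
        by (simp add: mult_ac)
      finally have "d * h ^ j = fps_X * ((d * h ^ j') * (A oo h))" .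
      then have "fps_nth (d * h ^ j) (Suc i) = fps_nth ((d * h ^ j') * (A oo h)) i"
        by (simp only: fps_X_mult_nth) simp
      also have "\<dots> = (\<Sum>r\<le>i. fps_nth A r * fps_nth (d * h ^ (j' + r)) i)"
        unfolding fps_nth_mult_compose[OF h(1)] by (simp add: power_add mult.assoc)
      finally show ?thesis
        using A Suc Suc.IH by (simp add: is_A_sequence_def riordan_array_def)
    qed
  qed
  then have "M = riordan_array d h"
    by (intro ext)
  moreover have "fps_nth d 0 \<noteq> 0" "fps_nth h 1 \<noteq> 0"
    using d0 M00 h(2) A0 by simp_all
  ultimately show ?thesis
    unfolding proper_riordan_array_def using h(1) by blast
qed

lemma one_plus_fps_X_power_nth:
  "fps_nth ((1 + fps_X :: 'a::field_char_0 fps) ^ n) r = of_nat (n choose r)"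
  by (simp flip: fps_binomial_of_nat add: binomial_gbinomial)

section \<open>Counting paths above a line\<close>

text \<open>Length and end height are arbitrary, so that last steps can be removed one at a time.
  The first coordinate of the end point is just the length.\<close>

definition floor_paths :: "nat \<Rightarrow> nat \<Rightarrow> nat \<Rightarrow> int \<Rightarrow> (int \<times> int) list set" where
  "floor_paths k a l y =
     {p. set p \<subseteq> {(1, 1), (1, 1 - int k)} \<and> length p = l \<and> snd (sum_list p) = y \<and>
         (\<forall>i\<le>length p. - int a \<le> snd (sum_list (take i p)))}"

definition floor_path_number :: "nat \<Rightarrow> nat \<Rightarrow> nat \<Rightarrow> int \<Rightarrow> int" where
  "floor_path_number k a l y = int (card (floor_paths k a l y))"

lemma fst_sum_list_steps:
  assumes "set p \<subseteq> {(1, 1), (1, 1 - int k)}"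
  shows "fst (sum_list p) = int (length p)"
  using assms by (induction p) auto

lemma snd_sum_list_steps_le:
  assumes "set p \<subseteq> {(1, 1), (1, 1 - int k)}"
  shows "snd (sum_list p) \<le> int (length p)"
  using assms by (induction p) auto

lemma gen_dyck_paths_eq_floor_paths:
  "gen_dyck_paths k a n m = floor_paths k a (k * n) (int (k * m))"
  unfolding gen_dyck_paths_def floor_paths_def
  using fst_sum_list_steps[of _ k] by (auto simp: prod_eq_iff simp flip: of_nat_mult)

lemma finite_floor_paths: "finite (floor_paths k a l y)"
  by (rule finite_subset[OF _ finite_lists_length_eq[of "{(1, 1), (1, 1 - int k)}" l]])
     (auto simp: floor_paths_def)

lemma floor_paths_0: "floor_paths k a 0 y = (if y = 0 then {[]} else {})"
  by (auto simp: floor_paths_def)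

lemma floor_path_number_below:
  assumes "y < - int a"
  shows "floor_path_number k a l y = 0"
proof -
  have "p \<notin> floor_paths k a l y" for p
    using assms by (auto simp: floor_paths_def dest!: spec[of _ "length p"])
  then have "floor_paths k a l y = {}"
    by blast
  then show ?thesis
    by (simp add: floor_path_number_def)
qed

lemma floor_path_number_above:
  assumes "int l < y"
  shows "floor_path_number k a l y = 0"
proof -
  have "p \<notin> floor_paths k a l y" for p
    using assms snd_sum_list_steps_le[of p k] by (auto simp: floor_paths_def)
  then have "floor_paths k a l y = {}"
    by blast
  then show ?thesis
    by (simp add: floor_path_number_def)
qed

lemma snoc_mem_floor_paths:
  "p @ [s] \<in> floor_paths k a (Suc l) y \<longleftrightarrow>
     - int a \<le> y \<and> s \<in> {(1, 1), (1, 1 - int k)} \<and> p \<in> floor_paths k a l (y - snd s)"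
proof -
  have "(\<forall>i\<le>Suc (length p). P i) \<longleftrightarrow> (\<forall>i\<le>length p. P i) \<and> P (Suc (length p))" for P
    by (auto simp: le_Suc_eq)
  then show ?thesis
    by (auto simp: floor_paths_def)
qed

text \<open>Split by the last step; \<open>k > 0\<close> makes the two kinds of step
  distinct.\<close>

lemma floor_path_number_Suc:
  assumes "k > 0" and "- int a \<le> y"
  shows "floor_path_number k a (Suc l) y
       = floor_path_number k a l (y - 1) + floor_path_number k a l (y - 1 + int k)"
proof -
  let ?U = "(\<lambda>p. p @ [(1, 1)]) ` floor_paths k a l (y - 1)"
  let ?D = "(\<lambda>p. p @ [(1, 1 - int k)]) ` floor_paths k a l (y - 1 + int k)"
  have "p \<in> floor_paths k a (Suc l) y \<longleftrightarrow> p \<in> ?U \<union> ?D" for p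
  proof (cases p rule: rev_cases)
    case Nil
    then show ?thesis
      by (auto simp: floor_paths_def)
  next
    case (snoc q s)
    then show ?thesis
      using assms by (auto simp: snoc_mem_floor_paths algebra_simps)
  qed
  then have "floor_paths k a (Suc l) y = ?U \<union> ?D"
    by blast
  moreover have "?U \<inter> ?D = {}"
    using assms by auto
  ultimately have "card (floor_paths k a (Suc l) y) = card ?U + card ?D"
    by (simp add: card_Un_disjoint finite_floor_paths)
  then show ?thesis
    by (simp add: floor_path_number_def card_image inj_on_def)
qed

lemma sum_choose_extend:
  fixes f :: "nat \<Rightarrow> int"
  assumes "j \<le> n"
  shows "(\<Sum>s\<le>n. int (j choose s) * f s) = (\<Sum>s\<le>j. int (j choose s) * f s)"
  using assms by (intro sum.mono_neutral_right) auto

lemma sum_choose_Suc: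
  fixes f :: "nat \<Rightarrow> int"
  shows "(\<Sum>s\<le>Suc j. int (Suc j choose s) * f s)
       = (\<Sum>s\<le>j. int (j choose s) * f s) + (\<Sum>s\<le>j. int (j choose s) * f (Suc s))"
proof -
  have "(\<Sum>s\<le>j. int (j choose s) * f s) = (\<Sum>s\<le>Suc j. int (j choose s) * f s)"
    by simp
  also have "\<dots> = f 0 + (\<Sum>s\<le>j. int (j choose Suc s) * f (Suc s))"
    by (subst sum.atMost_Suc_shift) simp
  finally show ?thesis
    by (subst sum.atMost_Suc_shift) (simp add: sum.distrib algebra_simps)
qed

text \<open>Of the last \<open>j\<close> steps, \<open>s\<close> are down steps, in any order. These
  steps end at heights at least \<open>y - (j - 1)\<close>, hence at least \<open>-a\<close>, so the
  bound constrains only the first \<open>l\<close> steps.\<close>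

lemma floor_path_number_add:
  assumes "k > 0" and "int j \<le> y + int a + 1"
  shows "floor_path_number k a (l + j) y
       = (\<Sum>s\<le>j. int (j choose s) * floor_path_number k a l (y - int j + int (k * s)))"
  using assms(2)
proof (induction j arbitrary: y)
  case 0
  then show ?case by simp
next
  case (Suc j)
  let ?f = "\<lambda>s. floor_path_number k a l (y - int (Suc j) + int (k * s))"
  have "floor_path_number k a (l + Suc j) y
      = floor_path_number k a (l + j) (y - 1) + floor_path_number k a (l + j) (y - 1 + int k)"
    using floor_path_number_Suc[OF assms(1), of a y "l + j"] Suc.prems by simp
  also have "floor_path_number k a (l + j) (y - 1)
      = (\<Sum>s\<le>j. int (j choose s) * ?f s)"
    using Suc.prems by (subst Suc.IH) (simp_all add: algebra_simps)
  also have "floor_path_number k a (l + j) (y - 1 + int k)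
      = (\<Sum>s\<le>j. int (j choose s) * ?f (Suc s))"
    using Suc.prems by (subst Suc.IH) (simp_all add: algebra_simps)
  also have "(\<Sum>s\<le>j. int (j choose s) * ?f s) + (\<Sum>s\<le>j. int (j choose s) * ?f (Suc s))
      = (\<Sum>s\<le>Suc j. int (Suc j choose s) * ?f s)"
    by (rule sum_choose_Suc[symmetric])
  finally show ?case .
qed

text \<open>
  Here \<open>p\<close> trailing up steps start below the line, and they are the only obstruction because
  of \<open>j \<le> p + k\<close>: a single down step read backwards lifts the path high enough.
\<close>
lemma floor_path_number_add_near_floor:
  assumes "k > 0" and "p \<le> j" and "j \<le> p + k"
  shows "floor_path_number k a (l + j) (int p - int a - 1)
       = (\<Sum>s\<le>j. int (j choose s) * floor_path_number k a l (int p - int a - 1 - int j + int (k * s)))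
         - (\<Sum>s\<le>j - p. int (j - p choose s)
              * floor_path_number k a l (int p - int a - 1 - int j + int (k * s)))"
  using assms(2,3)
proof (induction p arbitrary: j)
  case 0
  \<comment> \<open>The end point lies below the line, so there is no path, and the two sums
    cancel.\<close>
  then show ?case by (simp add: floor_path_number_below)
next
  case (Suc p)
  then obtain i where j: "j = Suc i"
    by (cases j) auto
  let ?y = "int p - int a - 1"
  let ?f = "\<lambda>s. floor_path_number k a l (?y - int i + int (k * s))"
  have "floor_path_number k a (l + j) (?y + 1)
      = floor_path_number k a (l + i) ?y + floor_path_number k a (l + i) (?y + int k)"
    using floor_path_number_Suc[OF assms(1), of a "?y + 1" "l + i"] j by simp
  also have "floor_path_number k a (l + i) ?y
      = (\<Sum>s\<le>i. int (i choose s) * ?f s) - (\<Sum>s\<le>i - p. int (i - p choose s) * ?f s)"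
    using Suc.IH[of i] Suc.prems j by simp
  \<comment> \<open>Before a final down step the height is \<open>?y + int k\<close>, and
    \<open>i \<le> p + k\<close> is exactly the bound under which the other \<open>i\<close> steps
    are unrestricted.\<close>
  also have "floor_path_number k a (l + i) (?y + int k)
      = (\<Sum>s\<le>i. int (i choose s) * ?f (Suc s))"
    using Suc.prems j by (subst floor_path_number_add[OF assms(1)]) (auto simp: algebra_simps)
  \<comment> \<open>Pascal's rule merges the two positive sums; the subtracted one stays, since
    \<open>j - Suc p = i - p\<close>.\<close>
  finally have "floor_path_number k a (l + j) (?y + 1)
      = (\<Sum>s\<le>j. int (j choose s) * ?f s) - (\<Sum>s\<le>j - Suc p. int (j - Suc p choose s) * ?f s)"
    unfolding j sum_choose_Suc by simp
  then show ?case
    by (simp add: j algebra_simps)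
qed

section \<open>The array of generalized Dyck paths\<close>

text \<open>Above the diagonal the end height exceeds the number of steps, so the path count is 0,
  in agreement with the cutoff in the array.\<close>

lemma gen_dyck_array_eq:
  assumes "k > 0"
  shows "(gen_dyck_array k a n m :: 'a::field_char_0)
       = of_int (floor_path_number k a (k * n) (int (k * m)))"
proof (cases "m \<le> n")
  case True
  then show ?thesis
    by (simp add: gen_dyck_array_def gen_dyck_number_def gen_dyck_paths_eq_floor_paths
        floor_path_number_def)
next
  case False
  then have "int (k * n) < int (k * m)"
    using assms by (simp del: of_nat_mult)
  with False show ?thesis
    by (simp add: gen_dyck_array_def floor_path_number_above del: of_nat_mult)
qed

lemma gen_dyck_array_above_diagonal: "n < m \<Longrightarrow> gen_dyck_array k a n m = 0"
  by (simp add: gen_dyck_array_def)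

lemma sum_atMost_eq_if_zero_beyond:
  fixes f :: "nat \<Rightarrow> 'a::comm_monoid_add"
  assumes "\<And>r. r > m \<Longrightarrow> f r = 0" and "\<And>r. r > n \<Longrightarrow> f r = 0"
  shows "(\<Sum>r\<le>m. f r) = (\<Sum>r\<le>n. f r)"
proof -
  have "(\<Sum>r\<le>m. f r) = (\<Sum>r\<le>min m n. f r)"
    by (rule sum.mono_neutral_right) (use assms in \<open>auto, metis not_le\<close>)
  also have "\<dots> = (\<Sum>r\<le>n. f r)"
    by (rule sum.mono_neutral_left) (use assms in \<open>auto, metis not_le\<close>)
  finally show ?thesis .
qed

lemma is_A_sequence_gen_dyck_array:
  assumes "k > 0"
  shows "is_A_sequence (gen_dyck_array k a :: nat \<Rightarrow> nat \<Rightarrow> 'a::field_char_0) ((1 + fps_X) ^ k)"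
  unfolding is_A_sequence_def
proof (intro allI)
  fix i j
  let ?M = "gen_dyck_array k a :: nat \<Rightarrow> nat \<Rightarrow> 'a"
  \<comment> \<open>Removing the last \<open>k\<close> steps, \<open>s\<close> of them down, leaves
    a path that ends at height \<open>k * (j + s)\<close> and is counted in row
    \<open>i\<close>.\<close>
  have "floor_path_number k a (k * i + k) (int (k * Suc j))
      = (\<Sum>s\<le>k. int (k choose s) * floor_path_number k a (k * i) (int (k * (j + s))))"
    using assms by (subst floor_path_number_add) (simp_all add: algebra_simps)
  then have "?M (Suc i) (Suc j) = (\<Sum>s\<le>k. of_nat (k choose s) * ?M i (j + s))"
    unfolding gen_dyck_array_eq[OF assms] by (simp add: add.commute)
  \<comment> \<open>The binomials vanish for \<open>s > k\<close> and the entries for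
    \<open>j + s > i\<close>, so both ranges give the same sum.\<close>
  also have "\<dots> = (\<Sum>s\<le>i. of_nat (k choose s) * ?M i (j + s))"
    by (rule sum_atMost_eq_if_zero_beyond) (simp_all add: gen_dyck_array_above_diagonal)
  finally show "?M (Suc i) (Suc j) = (\<Sum>r\<le>i. fps_nth ((1 + fps_X) ^ k) r * ?M i (j + r))"
    by (simp add: one_plus_fps_X_power_nth)
qed

lemma is_Z_sequence_gen_dyck_array:
  assumes "k > 0" and "a \<le> k - 1"
  shows "is_Z_sequence (gen_dyck_array k a :: nat \<Rightarrow> nat \<Rightarrow> 'a::field_char_0)
           (((1 + fps_X) ^ k - (1 + fps_X) ^ (k - a - 1)) / fps_X)"
  unfolding is_Z_sequence_def
proof (intro allI)
  fix i
  let ?M = "gen_dyck_array k a :: nat \<Rightarrow> nat \<Rightarrow> 'a"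
  let ?c = "\<lambda>s. int (k choose s) - int (k - a - 1 choose s)"
  let ?f = "\<lambda>s. floor_path_number k a (k * i) (int (k * s) - int k)"
  obtain k' where k': "k = Suc k'"
    using assms(1) by (cases k) auto
  \<comment> \<open>End height 0 is the case \<open>p = a + 1\<close>, \<open>j = k\<close> near the
    floor; \<open>p \<le> j\<close> is the assumption on \<open>a\<close>.\<close>
  have "floor_path_number k a (k * i + k) 0
      = (\<Sum>s\<le>k. int (k choose s) * ?f s) - (\<Sum>s\<le>k - a - 1. int (k - a - 1 choose s) * ?f s)"
    using floor_path_number_add_near_floor[of k "Suc a" k a "k * i"] assms
    by (simp add: algebra_simps)
  also have "(\<Sum>s\<le>k - a - 1. int (k - a - 1 choose s) * ?f s)
      = (\<Sum>s\<le>k. int (k - a - 1 choose s) * ?f s)"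
    by (rule sum_choose_extend[symmetric]) simp
  also have "(\<Sum>s\<le>k. int (k choose s) * ?f s) - \<dots> = (\<Sum>s\<le>k. ?c s * ?f s)"
    by (simp add: sum_subtractf left_diff_distrib)
  \<comment> \<open>The term \<open>s = 0\<close> cancels, both binomials being 1; the index shift
    is the division by t in \<open>Z\<close>.\<close>
  also have "\<dots> = (\<Sum>r\<le>k'. ?c (Suc r) * floor_path_number k a (k * i) (int (k * r)))"
    unfolding k' by (subst sum.atMost_Suc_shift) (simp add: algebra_simps)
  finally have "?M (Suc i) 0 = (\<Sum>r\<le>k'. of_int (?c (Suc r)) * ?M i r)"
    unfolding gen_dyck_array_eq[OF assms(1)] by (simp add: add.commute)
  also have "\<dots> = (\<Sum>r\<le>i. of_int (?c (Suc r)) * ?M i r)"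
    by (rule sum_atMost_eq_if_zero_beyond)
       (simp_all add: k' gen_dyck_array_above_diagonal binomial_eq_0 del: binomial_Suc_Suc)
  finally show "?M (Suc i) 0
      = (\<Sum>r\<le>i. fps_nth (((1 + fps_X) ^ k - (1 + fps_X) ^ (k - a - 1)) / fps_X) r * ?M i r)"
    by (simp add: one_plus_fps_X_power_nth)
qed

theorem theorem3p1:
  fixes k a :: nat
  assumes "k \<ge> 2" and "a \<le> k - 1"
  shows "proper_riordan_array (gen_dyck_array k a :: nat \<Rightarrow> nat \<Rightarrow> 'a::field_char_0) \<and>
         is_A_sequence (gen_dyck_array k a :: nat \<Rightarrow> nat \<Rightarrow> 'a) ((1 + fps_X) ^ k) \<and>
         is_Z_sequence (gen_dyck_array k a :: nat \<Rightarrow> nat \<Rightarrow> 'a)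
           (((1 + fps_X) ^ k - (1 + fps_X) ^ (k - a - 1)) / fps_X)"
proof -
  have k: "k > 0"
    using assms(1) by simp
  note A = is_A_sequence_gen_dyck_array[OF k, of a, where 'a = 'a]
  note Z = is_Z_sequence_gen_dyck_array[OF k assms(2), where 'a = 'a]
  have "proper_riordan_array (gen_dyck_array k a :: nat \<Rightarrow> nat \<Rightarrow> 'a)"
  proof (rule proper_riordan_arrayI[OF _ _ A _ Z])
    show "(gen_dyck_array k a 0 0 :: 'a) \<noteq> 0"
      unfolding gen_dyck_array_eq[OF k] by (simp add: floor_path_number_def floor_paths_0)
  qed (simp_all add: gen_dyck_array_above_diagonal one_plus_fps_X_power_nth)
  with A Z show ?thesis by blast
qed

end
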